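(* Let $\Omega$ be a domain in $\mathbf{R}^3$ and let $A=(A_{ij})_{1\le i,j\le 3}$, where the $A_{ij}$ are real constants satisfying, for constants $C_1,C_2>0$, $$|A_{ij}|\le C_1\quad(1\le i,j\le 3),\qquad |\det A|^{-1}\le C_2,$$ $$(A_{11}A_{22}-A_{12}A_{21})(A_{11}A_{33}-A_{13}A_{31})(A_{22}A_{33}-A_{23}A_{32})\ne 0,$$ $$A_{11}A_{22}A_{33}\neq 0,$$ $$(A_{11}A_{22}+A_{21}A_{12})(A_{11}A_{22}-3A_{21}A_{12})>0,$$ $$(A_{11}A_{33}+A_{31}A_{13})(A_{11}A_{33}-3A_{31}A_{13})>0,$$ $$(A_{22}A_{33}+A_{23}A_{32})(A_{22}A_{33}-3A_{23}A_{32})>0.$$ Let $b_{ij}$ $(1\le i,j\le 3)$ be real constants with $|b_{ij}|\le C_3$ for $1\le i,j\le 3$, where $C_3>0$ is a constant. Suppose that a real valued function $u\in C^2(\Omega)$ satisfies, for constants $C_4,C_5$, $$-\sum_{j=1}^{3}\Big\{\frac{\partial}{\partial x_i}\Big(A_{ij}\frac{\partial u}{\partial x_j}\Big)+b_{ij}\frac{\partial u}{\partial x_j}\Big\}(x_1,x_2,x_3)\le C_4\quad\text{in }\Omega,\quad \text{for all } 1\le i\le 3,$$ $$\sup_{(x_1,x_2,x_3)\in\Omega}|u|\le C_5 .$$ Then for any $(y_1,y_2,y_3)\in\Omega$ and for any $\delta>0$ such that $$\delta\left|\frac{A_{ij}b_{ji}}{A_{ii}A_{jj}-A_{ij}A_{ji}+2|A_{ij}A_{ji}|}\right|\left(1+\left|\frac{A_{ij}A_{ji}}{A_{ii}A_{jj}}\right|\right)<\frac18,\qquad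 1\le i\ne j\le 3,$$ $$\delta\left|\frac{A_{ij}b_{ij}}{A_{ii}A_{jj}-A_{ij}A_{ji}-2|A_{ij}A_{ji}|}\right|\left(1+\left|\frac{A_{ij}A_{ji}}{A_{ii}A_{jj}}\right|\right)<\frac18,\qquad 1\le i\ne j\le 3,$$ $$K'=[y_1-2\delta,y_1+2\delta]\times[y_2-2\delta,y_2+2\delta]\times[y_3-2\delta,y_3+2\delta]\subset\Omega,$$ setting $K=[y_1-\delta,y_1+\delta]\times[y_2-\delta,y_2+\delta]\times[y_3-\delta,y_3+\delta]$, there exists a constant $\overline{C}>0$, depending on $\delta$, the matrices $(A_{ij})$, $(b_{ij})$, and the constants $C_4,C_5$, such that $$\sup_{(x_1,x_2,x_3)\in K}|\nabla u|\le\overline{C},\qquad \overline{C}=O\Big(\frac1\delta\Big).$$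
   Context: There is no summation over repeated indices unless written: there is one differential inequality for each $i$, and the two smallness conditions on $\delta$ are required for every pair $i\neq j$. *)

theory Defs
  imports "HOL-Analysis.Analysis" "HOL-Library.Landau_Symbols"
begin

definition partial_deriv :: "'n::finite \<Rightarrow> (real^'n \<Rightarrow> real) \<Rightarrow> real^'n \<Rightarrow> real" where
  "partial_deriv i f x = deriv (\<lambda>t. f (x + t *\<^sub>R axis i 1)) 0"

definition grad :: "(real^'n::finite \<Rightarrow> real) \<Rightarrow> real^'n \<Rightarrow> real^'n" where
  "grad f x = (\<chi> i. partial_deriv i f x)"

text \<open>The next two notions are meant for open \<open>S\<close>. The differentiability requirement
  makes the partial derivatives exist; without it \<^const>\<open>deriv\<close> returns an
  unspecified value.\<close>

definition C1_on :: "(real^'n::finite) set \<Rightarrow> (real^'n \<Rightarrow> real) \<Rightarrow> bool" where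
  "C1_on S f \<longleftrightarrow> f differentiable_on S \<and> (\<forall>i. continuous_on S (partial_deriv i f))"

definition C2_on :: "(real^'n::finite) set \<Rightarrow> (real^'n \<Rightarrow> real) \<Rightarrow> bool" where
  "C2_on S f \<longleftrightarrow> C1_on S f \<and> (\<forall>i. C1_on S (partial_deriv i f))"

definition cube :: "real^'n::finite \<Rightarrow> real \<Rightarrow> (real^'n) set" where
  "cube y r = cbox (\<chi> i. y $ i - r) (\<chi> i. y $ i + r)"

end

theory Submission
  imports Defs
begin

text \<open>
  Put \<open>v\<^sub>k = \<Sum>\<^sub>j A\<^sub>k\<^sub>j \<partial>\<^sub>j u\<close>. As long as the gradient is bounded by \<open>G\<close>, the \<open>k\<close>-th inequality says
  \<open>\<partial>\<^sub>k v\<^sub>k \<ge> -e\<close> with \<open>e = O(1 + G)\<close>: each \<open>v\<^sub>k\<close> is almost increasing in its own direction \<open>e\<^sub>k\<close>.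
  The estimate combines this monotonicity with averages over faces of a small cube of size \<open>h\<close>.

  Fix a point \<open>x\<close> and, for a set \<open>T\<close> of directions, average over a face through \<open>x\<close> that extends
  by \<open>h\<close> in the directions of \<open>T\<close> and is a point in the others. For \<open>l \<in> T\<close> the average of
  \<open>\<partial>\<^sub>l u\<close> is a difference quotient of \<open>u\<close>, hence at most \<open>2 sup |u| / h\<close>. For \<open>k \<notin> T\<close> the average
  of \<open>v\<^sub>k\<close> over the face of \<open>T\<close> lies, up to \<open>e h\<close>, between its averages over the two faces
  of \<open>T \<union> {k}\<close> that extend forwards and backwards along \<open>e\<^sub>k\<close>. So if the averages of the whole
  gradient over all faces with one more direction are \<open>O(1/h + e h)\<close>, then for the face of \<open>T\<close> we
  control the averages of \<open>\<partial>\<^sub>l u\<close>, \<open>l \<in> T\<close>, and of \<open>v\<^sub>k\<close>, \<open>k \<notin> T\<close>. These determine the average of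
  the gradient, because the principal submatrix of \<open>A\<close> with indices outside \<open>T\<close> is nonsingular.
  Starting from full cubes, where every direction belongs to \<open>T\<close>, and removing directions one at a
  time, we arrive at \<open>T = {}\<close>, which is the value of the gradient at \<open>x\<close>
  (lemma \<open>point_gradient_bound\<close>).

  It remains to remove the dependence of \<open>e\<close> on the gradient. Apply the estimate at the point \<open>x\<close> of
  a ball of radius \<open>R\<close> where the product of \<open>|\<nabla>u|\<close> with the distance \<open>d\<close> to the boundary sphere
  attains its maximum \<open>M\<close>, with \<open>h\<close> proportional to \<open>d\<close>. On the cube \<open>|\<nabla>u|\<close> is then at
  most \<open>2 M / d\<close>, and for small \<open>R\<close> the first order terms contribute at most \<open>M / 2\<close> to the bound
  for \<open>M\<close> (lemma \<open>interior_gradient_bound\<close>). The resulting bound \<open>O(1/R)\<close> at the centre is used at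
  every point of the smaller cube.

  In dimension three the nonsingularity of the principal submatrices is exactly what the hypotheses
  on the diagonal entries, the \<open>2 \<times> 2\<close> minors and the determinant provide.
\<close>

section \<open>Averages over faces of a cube\<close>

text \<open>Discrete averages are used instead of integrals: they commute, are linear and are monotone for
  arbitrary functions, so that no measurability or exchange of integrals has to be
  discussed. The price is a discretisation error, which is removed by letting the number of nodes
  grow. A pair \<open>(i, \<tau>)\<close> stands for the segment from the origin to \<open>\<tau> e\<^sub>i\<close>, where \<open>\<tau>\<close> may be
  negative.\<close>

definition segment_average ::
  "nat \<Rightarrow> 'n::finite \<times> real \<Rightarrow> (real^'n \<Rightarrow> real) \<Rightarrow> real^'n \<Rightarrow> real" where
  "segment_average N d f x =
     (\<Sum>m<N. f (x + (real m / real N * snd d) *\<^sub>R axis (fst d) 1)) / real N"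

definition grid_average ::
  "nat \<Rightarrow> ('n::finite \<times> real) list \<Rightarrow> (real^'n \<Rightarrow> real) \<Rightarrow> real^'n \<Rightarrow> real" where
  "grid_average N ds f = foldr (segment_average N) ds f"

definition face :: "real^'n::finite \<Rightarrow> real \<Rightarrow> 'n set \<Rightarrow> (real^'n) set" where
  "face x r T = {y. \<forall>i. if i \<in> T then \<bar>y$i - x$i\<bar> \<le> r else y$i = x$i}"

lemma mem_cube: "y \<in> cube x r \<longleftrightarrow> (\<forall>i. \<bar>y$i - x$i\<bar> \<le> r)"
  unfolding cube_def mem_box_cart by (simp add: abs_le_iff) (smt (verit))

lemma face_subset_cube: "r \<ge> 0 \<Longrightarrow> face x r T \<subseteq> cube x r"
proof
  fix y assume "r \<ge> 0" "y \<in> face x r T"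
  then have "\<bar>y$i - x$i\<bar> \<le> r" for i
    by (cases "i \<in> T") (auto simp: face_def)
  then show "y \<in> cube x r" by (simp add: mem_cube)
qed

lemma move_in_face:
  assumes "y \<in> face x r T" "k \<notin> T" "\<bar>t\<bar> \<le> r"
  shows "y + t *\<^sub>R axis k 1 \<in> face x r (insert k T)"
  using assms by (auto simp: face_def axis_def)

lemma grid_average_Nil [simp]: "grid_average N [] f = f"
  and grid_average_Cons: "grid_average N (d # ds) f = segment_average N d (grid_average N ds f)"
  by (simp_all add: grid_average_def)

lemma segment_average_commute:
  "segment_average N c (segment_average N d f) = segment_average N d (segment_average N c f)"
proof
  fix x
  have "segment_average N c (segment_average N d f) x =
     (\<Sum>m<N. \<Sum>k<N. f (x + (real m / real N * snd c) *\<^sub>R axis (fst c) 1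
        + (real k / real N * snd d) *\<^sub>R axis (fst d) 1)) / real N / real N"
    by (simp add: segment_average_def sum_divide_distrib)
  also have "\<dots> = (\<Sum>k<N. \<Sum>m<N. f (x + (real k / real N * snd d) *\<^sub>R axis (fst d) 1
        + (real m / real N * snd c) *\<^sub>R axis (fst c) 1)) / real N / real N"
    by (subst sum.swap) (simp add: ac_simps)
  also have "\<dots> = segment_average N d (segment_average N c f) x"
    by (simp add: segment_average_def sum_divide_distrib)
  finally show "segment_average N c (segment_average N d f) x =
    segment_average N d (segment_average N c f) x" .
qed

text \<open>Moving a direction to the innermost position is what allows a derivative in that direction to
  be averaged first.\<close>

lemma grid_average_Cons_inner:
  "grid_average N (d # ds) f = grid_average N ds (segment_average N d f)"
proof (induction ds arbitrary: f)
  case Nil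
  then show ?case by (simp add: grid_average_Cons)
next
  case (Cons c ds)
  then show ?case
    by (metis grid_average_Cons segment_average_commute)
qed

lemma grid_average_remove:
  assumes "d \<in> set ds"
  shows "grid_average N ds f = grid_average N (remove1 d ds) (segment_average N d f)"
  using assms
proof (induction ds)
  case (Cons c ds)
  then show ?case
    by (cases "c = d") (simp_all add: grid_average_Cons_inner[symmetric],
        metis grid_average_Cons segment_average_commute)
qed simp

lemma segment_average_sum:
  "segment_average N d (\<lambda>x. \<Sum>j\<in>S. c j * f j x) x = (\<Sum>j\<in>S. c j * segment_average N d (f j) x)"
  unfolding segment_average_def
  by (simp add: sum_divide_distrib sum_distrib_left) (rule sum.swap)

lemma grid_average_sum:
  "grid_average N ds (\<lambda>x. \<Sum>j\<in>S. c j * f j x) = (\<lambda>x. \<Sum>j\<in>S. c j * grid_average N ds (f j) x)"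
proof (induction ds)
  case (Cons d ds)
  show ?case unfolding grid_average_Cons Cons.IH by (rule ext) (rule segment_average_sum)
qed simp

lemma segment_average_const: "N > 0 \<Longrightarrow> segment_average N d (\<lambda>x. c) = (\<lambda>x. c)"
  by (simp add: segment_average_def fun_eq_iff)

lemma grid_average_const: "N > 0 \<Longrightarrow> grid_average N ds (\<lambda>x. c) = (\<lambda>x. c)"
  by (induction ds) (simp_all add: grid_average_Cons segment_average_const)

lemma segment_average_add_const:
  "N > 0 \<Longrightarrow> segment_average N d (\<lambda>x. f x + c) = (\<lambda>x. segment_average N d f x + c)"
  by (simp add: segment_average_def sum.distrib add_divide_distrib fun_eq_iff)

lemma grid_average_add_const:
  "N > 0 \<Longrightarrow> grid_average N ds (\<lambda>x. f x + c) = (\<lambda>x. grid_average N ds f x + c)"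
  by (induction ds) (simp_all add: grid_average_Cons segment_average_add_const)

lemma grid_average_mono:
  assumes "N > 0" "distinct (map fst ds)" "\<And>d. d \<in> set ds \<Longrightarrow> \<bar>snd d\<bar> \<le> r"
    and "\<And>y. y \<in> face x r (fst ` set ds) \<Longrightarrow> f y \<le> g y"
  shows "grid_average N ds f x \<le> grid_average N ds g x"
  using assms(2-)
proof (induction ds arbitrary: x)
  case Nil
  then show ?case by (simp add: face_def)
next
  case (Cons d ds)
  let ?z = "\<lambda>m. x + (real m / real N * snd d) *\<^sub>R axis (fst d) 1"
  have "grid_average N ds f (?z m) \<le> grid_average N ds g (?z m)" if "m < N" for m
  proof (rule Cons.IH)
    have len: "\<bar>real m / real N * snd d\<bar> \<le> r"
    proof -
      have "\<bar>real m / real N * snd d\<bar> = real m / real N * \<bar>snd d\<bar>"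
        by (simp add: abs_mult)
      also have "\<dots> \<le> 1 * \<bar>snd d\<bar>"
        using that by (intro mult_right_mono) auto
      finally show ?thesis using Cons.prems(2)[of d] by simp
    qed
    fix y assume y: "y \<in> face (?z m) r (fst ` set ds)"
    have "fst d \<notin> fst ` set ds" using Cons.prems(1) by auto
    have yi: "if i \<in> fst ` set ds then \<bar>y$i - ?z m$i\<bar> \<le> r else y$i = ?z m$i" for i
      using y unfolding face_def by blast
    have "if i \<in> fst ` set (d # ds) then \<bar>y$i - x$i\<bar> \<le> r else y$i = x$i" for i
      using yi[of i] len \<open>fst d \<notin> _\<close> by (cases "i = fst d") (auto simp: axis_def split: if_splits)
    then have "y \<in> face x r (fst ` set (d # ds))"
      unfolding face_def by blast
    then show "f y \<le> g y" by (rule Cons.prems(3))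
  qed (use Cons.prems in auto)
  then show ?case
    unfolding grid_average_Cons segment_average_def
    by (intro divide_right_mono sum_mono) auto
qed

lemma grid_average_abs_le:
  assumes "N > 0" "distinct (map fst ds)" "\<And>d. d \<in> set ds \<Longrightarrow> \<bar>snd d\<bar> \<le> r"
    and "\<And>y. y \<in> face x r (fst ` set ds) \<Longrightarrow> \<bar>f y\<bar> \<le> B"
  shows "\<bar>grid_average N ds f x\<bar> \<le> B"
proof -
  have "grid_average N ds f x \<le> grid_average N ds (\<lambda>_. B) x"
    using assms by (intro grid_average_mono) (auto simp: abs_le_iff)
  moreover have "grid_average N ds (\<lambda>_. - B) x \<le> grid_average N ds f x"
    using assms by (intro grid_average_mono) (auto simp: abs_le_iff, smt (verit))
  ultimately show ?thesis using assms(1) by (simp add: grid_average_const)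
qed

lemma DERIV_along_line:
  fixes f :: "real^'n::finite \<Rightarrow> real"
  assumes "((\<lambda>s. f ((x + t *\<^sub>R w) + s *\<^sub>R w)) has_real_derivative D) (at 0)"
  shows "((\<lambda>s. f (x + s *\<^sub>R w)) has_real_derivative D) (at t)"
proof -
  have "((\<lambda>s. f (x + (s + t) *\<^sub>R w)) has_real_derivative D) (at 0)"
    using assms by (simp add: algebra_simps)
  then show ?thesis
    using DERIV_shift[of "\<lambda>s. f (x + s *\<^sub>R w)" D 0 t] by simp
qed

text \<open>A discrete form of the fundamental theorem of calculus: by the mean value theorem the Riemann
  sum of the derivative differs from the telescoping sum of increments by at most the oscillation \<open>\<epsilon>\<close> of
  the derivative between neighbouring nodes.\<close>

lemma segment_average_derivative:
  fixes g p :: "real^'n::finite \<Rightarrow> real"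
  assumes "N > 0" "\<tau> \<noteq> 0"
    and der: "\<And>s. 0 \<le> s \<Longrightarrow> s \<le> 1 \<Longrightarrow>
      ((\<lambda>t. g ((x + (s * \<tau>) *\<^sub>R axis l 1) + t *\<^sub>R axis l 1)) has_real_derivative
        p (x + (s * \<tau>) *\<^sub>R axis l 1)) (at 0)"
    and osc: "\<And>s t. 0 \<le> s \<Longrightarrow> s \<le> 1 \<Longrightarrow> 0 \<le> t \<Longrightarrow> t \<le> 1 \<Longrightarrow> \<bar>s - t\<bar> \<le> 1 / real N \<Longrightarrow>
      \<bar>p (x + (s * \<tau>) *\<^sub>R axis l 1) - p (x + (t * \<tau>) *\<^sub>R axis l 1)\<bar> \<le> \<epsilon>"
  shows "\<bar>segment_average N (l, \<tau>) p x - (g (x + \<tau> *\<^sub>R axis l 1) - g x) / \<tau>\<bar> \<le> \<epsilon>"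
proof -
  define q where "q s = p (x + (s * \<tau>) *\<^sub>R axis l 1)" for s
  define G where "G s = g (x + (s * \<tau>) *\<^sub>R axis l 1)" for s
  have dG: "(G has_real_derivative q s * \<tau>) (at s)" if "0 \<le> s" "s \<le> 1" for s
  proof -
    have "((\<lambda>t. g (x + t *\<^sub>R axis l 1)) has_real_derivative q s) (at (s * \<tau>))"
      unfolding q_def by (rule DERIV_along_line[OF der[OF that]])
    moreover have "((\<lambda>s. s * \<tau>) has_real_derivative \<tau>) (at s)"
      by (auto intro!: derivative_eq_intros)
    ultimately show ?thesis unfolding G_def
      by (rule DERIV_chain2[where f = "\<lambda>t. g (x + t *\<^sub>R axis l 1)" and g = "\<lambda>s. s * \<tau>"])
  qed
  have piece: "\<bar>(G (real (Suc m) / real N) - G (real m / real N)) / \<tau> - q (real m / real N) / real N\<bar>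
      \<le> \<epsilon> / real N" if "m < N" for m
  proof -
    have lt: "real m / real N < real (Suc m) / real N" "real (Suc m) / real N \<le> 1"
      using that assms(1) by (auto simp: divide_strict_right_mono)
    have m0: "0 \<le> real m / real N" by simp
    obtain z where z: "real m / real N < z" "z < real (Suc m) / real N"
      and "G (real (Suc m) / real N) - G (real m / real N)
           = (real (Suc m) / real N - real m / real N) * (q z * \<tau>)"
      using MVT2[of "real m / real N" "real (Suc m) / real N" G "\<lambda>s. q s * \<tau>"] lt m0
        dG by (metis dual_order.trans)
    moreover have w: "real (Suc m) / real N - real m / real N = 1 / real N"
      by (simp add: diff_divide_distrib[symmetric])
    ultimately have "(G (real (Suc m) / real N) - G (real m / real N)) / \<tau> = q z / real N"
      using assms(2) by simp
    moreover have "\<bar>q z - q (real m / real N)\<bar> \<le> \<epsilon>"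
    proof -
      have "0 \<le> z" "z \<le> 1" "real m / real N \<le> 1" "\<bar>z - real m / real N\<bar> \<le> 1 / real N"
        using z lt m0 w by linarith+
      then show ?thesis unfolding q_def using m0 by (intro osc)
    qed
    ultimately show ?thesis
      using assms(1) by (simp add: diff_divide_distrib[symmetric] divide_right_mono)
  qed
  have "(\<Sum>m<N. (G (real (Suc m) / real N) - G (real m / real N)) / \<tau>) = (G 1 - G 0) / \<tau>"
    using assms(1) sum_lessThan_telescope[of "\<lambda>m. G (real m / real N)" N]
    by (simp add: sum_divide_distrib[symmetric])
  moreover have "segment_average N (l, \<tau>) p x = (\<Sum>m<N. q (real m / real N) / real N)"
    by (simp add: segment_average_def q_def sum_divide_distrib)
  moreover have "G 1 = g (x + \<tau> *\<^sub>R axis l 1)" "G 0 = g x"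
    by (simp_all add: G_def)
  ultimately have "\<bar>segment_average N (l, \<tau>) p x - (g (x + \<tau> *\<^sub>R axis l 1) - g x) / \<tau>\<bar> =
     \<bar>\<Sum>m<N. (G (real (Suc m) / real N) - G (real m / real N)) / \<tau> - q (real m / real N) / real N\<bar>"
    by (simp add: sum_subtractf)
  also have "\<dots> \<le> (\<Sum>m<N. \<epsilon> / real N)"
    by (rule order_trans[OF sum_abs sum_mono]) (use piece in auto)
  also have "\<dots> = \<epsilon>" using assms(1) by simp
  finally show ?thesis .
qed



section \<open>Matrices with nonsingular principal submatrices\<close>

text \<open>All principal minors of \<open>A\<close> are nonzero: a vector \<open>z\<close> as below is a kernel vector of the
  principal submatrix on its support. The condition is necessary for any gradient bound, since for
  a nonzero such \<open>z\<close> and \<open>b = 0\<close> every function \<open>f (z \<bullet> x)\<close> satisfies the inequalities with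
  right-hand side \<open>0\<close>.\<close>

definition fully_nonsingular :: "real^'n^'n::finite \<Rightarrow> bool" where
  "fully_nonsingular A \<longleftrightarrow> (\<forall>z. (\<forall>i. z$i * (A *v z)$i = 0) \<longrightarrow> z = 0)"

text \<open>For each \<open>T\<close> the linear map that keeps the coordinates in \<open>T\<close> and replaces the others by those
  of \<open>A z\<close> is injective, hence bounded below; there are only finitely many \<open>T\<close>.\<close>

lemma fully_nonsingular_bound:
  fixes A :: "real^'n^'n::finite"
  assumes "fully_nonsingular A"
  obtains \<kappa> where "\<kappa> > 0"
    "\<And>T z. norm z \<le> \<kappa> * (\<Sum>i\<in>UNIV. \<bar>if i \<in> T then z$i else (A *v z)$i\<bar>)"
proof -
  have "\<exists>k>0. \<forall>z. norm z \<le> k * (\<Sum>i\<in>UNIV. \<bar>if i \<in> T then z$i else (A *v z)$i\<bar>)" for T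
  proof -
    define L where "L z = (\<chi> i. if i \<in> T then z$i else (A *v z)$i)" for z
    have "linear L"
      by (rule linearI) (auto simp: L_def vec_eq_iff matrix_vector_right_distrib
        matrix_vector_mult_scaleR)
    moreover have "inj L"
    proof (rule linear_injective_0[OF \<open>linear L\<close>, THEN iffD2], intro allI impI)
      fix z assume "L z = 0"
      then have "(if i \<in> T then z$i else (A *v z)$i) = 0" for i
        by (simp add: L_def vec_eq_iff)
      then have "\<forall>i. z$i * (A *v z)$i = 0" by (metis mult_eq_0_iff)
      then show "z = 0" using assms by (simp add: fully_nonsingular_def)
    qed
    ultimately obtain B where B: "B > 0" "\<And>z. B * norm z \<le> norm (L z)"
      using linear_inj_bounded_below_pos by metis
    have "norm z \<le> 1 / B * (\<Sum>i\<in>UNIV. \<bar>if i \<in> T then z$i else (A *v z)$i\<bar>)" for z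
    proof -
      have "B * norm z \<le> (\<Sum>i\<in>UNIV. \<bar>L z $ i\<bar>)"
        using B(2)[of z] norm_le_l1_cart[of "L z"] by linarith
      then show ?thesis using B(1) by (simp add: L_def field_simps)
    qed
    then show ?thesis using B(1) by (intro exI[of _ "1 / B"]) auto
  qed
  then obtain k where k: "\<And>T. k T > 0"
    "\<And>T z. norm z \<le> k T * (\<Sum>i\<in>UNIV. \<bar>if i \<in> T then z$i else (A *v z)$i\<bar>)"
    by metis
  show thesis
  proof (rule that)
    show "(\<Sum>T\<in>UNIV. k T) > 0" using k(1) by (intro sum_pos) auto
    fix T z
    have "k T \<le> (\<Sum>T\<in>UNIV. k T)" using k(1) by (intro member_le_sum) (auto simp: less_imp_le)
    then show "norm z \<le> (\<Sum>T\<in>UNIV. k T) * (\<Sum>i\<in>UNIV. \<bar>if i \<in> T then z$i else (A *v z)$i\<bar>)"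
      using k(2)[of z T] by (meson mult_right_mono order_trans sum_nonneg abs_ge_zero)
  qed
qed

section \<open>The gradient bound at a point\<close>

lemma increase_along_axis:
  fixes f :: "real^'n::finite \<Rightarrow> real"
  assumes "s \<le> t"
    and der: "\<And>r. s \<le> r \<Longrightarrow> r \<le> t \<Longrightarrow>
      \<exists>D\<ge>-e. ((\<lambda>q. f ((x + r *\<^sub>R axis k 1) + q *\<^sub>R axis k 1)) has_real_derivative D) (at 0)"
  shows "f (x + s *\<^sub>R axis k 1) \<le> f (x + t *\<^sub>R axis k 1) + e * (t - s)"
proof -
  have "f (x + s *\<^sub>R axis k 1) + e * s \<le> f (x + t *\<^sub>R axis k 1) + e * t"
  proof (rule DERIV_nonneg_imp_nondecreasing[OF assms(1), where f = "\<lambda>r. f (x + r *\<^sub>R axis k 1) + e * r"])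
    fix r assume "s \<le> r" "r \<le> t"
    from der[OF this] obtain D where D: "D \<ge> -e"
      and "((\<lambda>q. f ((x + r *\<^sub>R axis k 1) + q *\<^sub>R axis k 1)) has_real_derivative D) (at 0)" by blast
    from DERIV_along_line[OF this(2)]
    have "((\<lambda>r. f (x + r *\<^sub>R axis k 1) + e * r) has_real_derivative D + e) (at r)"
      by (auto intro!: derivative_eq_intros)
    with D show "\<exists>y. ((\<lambda>r. f (x + r *\<^sub>R axis k 1) + e * r) has_real_derivative y) (at r) \<and> 0 \<le> y"
      by (intro exI[of _ "D + e"]) auto
  qed
  then show ?thesis by (simp add: algebra_simps)
qed

text \<open>The downward induction over sets of directions. Each of the \<open>CARD('n)\<close> removals of a
  direction costs one factor \<open>1 + \<kappa> n (1 + a)\<close>: passing to \<open>v\<^sub>k\<close> costs the size \<open>a\<close> of \<open>A\<close>,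
  and solving for the gradient costs \<open>\<kappa>\<close>.\<close>

lemma point_gradient_bound:
  fixes A :: "real^'n^'n::finite" and u :: "real^'n \<Rightarrow> real" and p :: "'n \<Rightarrow> real^'n \<Rightarrow> real"
  defines "v \<equiv> \<lambda>k x. \<Sum>j\<in>UNIV. A$k$j * p j x"
    and "a \<equiv> \<Sum>i\<in>UNIV. \<Sum>j\<in>UNIV. \<bar>A$i$j\<bar>"
  assumes \<kappa>: "\<kappa> > 0"
    "\<And>T z. norm z \<le> \<kappa> * (\<Sum>i\<in>UNIV. \<bar>if i \<in> T then z$i else (A *v z)$i\<bar>)"
    and h: "h > 0" and e: "e \<ge> 0"
    and der_u: "\<And>x l. x \<in> cube x0 h \<Longrightarrow>
      ((\<lambda>t. u (x + t *\<^sub>R axis l 1)) has_real_derivative p l x) (at 0)"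
    and cont_p: "\<And>l. continuous_on (cube x0 h) (p l)"
    and der_v: "\<And>x k. x \<in> cube x0 h \<Longrightarrow>
      \<exists>D\<ge>-e. ((\<lambda>t. v k (x + t *\<^sub>R axis k 1)) has_real_derivative D) (at 0)"
    and bound_u: "\<And>x. x \<in> cube x0 h \<Longrightarrow> \<bar>u x\<bar> \<le> U"
  shows "\<bar>p l x0\<bar> \<le> (1 + \<kappa> * CARD('n) * (1 + a)) ^ CARD('n) * (2 * U / h + e * h)"
proof (rule field_le_epsilon)
  define c where "c = 1 + \<kappa> * CARD('n) * (1 + a)"
  have a0: "a \<ge> 0" unfolding a_def by (intro sum_nonneg) auto
  have c1: "c \<ge> 1" unfolding c_def using \<kappa>(1) a0 by simp
  fix \<epsilon>' :: real assume "\<epsilon>' > 0"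
  define \<epsilon> where "\<epsilon> = \<epsilon>' / c ^ CARD('n)"
  have \<epsilon>: "\<epsilon> > 0" unfolding \<epsilon>_def using \<open>\<epsilon>' > 0\<close> c1 by simp
  \<comment> \<open>Bound for the averages over a full cube. Its last term only serves to absorb the error of the
    monotonicity argument at each later step.\<close>
  define \<beta> where "\<beta> = 2 * U / h + \<epsilon> + e * h"
  have "x0 \<in> cube x0 h" using h by (simp add: mem_cube)
  then have U0: "U \<ge> 0" using bound_u by fastforce
  have \<beta>0: "\<beta> \<ge> 0" unfolding \<beta>_def using U0 h e \<epsilon> by simp
  have eh: "e * h \<ge> 0" using e h by simp
  have "uniformly_continuous_on (cube x0 h) (p l)" for l
    using cont_p compact_cbox unfolding cube_def by (intro compact_uniformly_continuous) auto
  then have "\<exists>\<eta>>0. \<forall>x\<in>cube x0 h. \<forall>y\<in>cube x0 h. dist x y < \<eta> \<longrightarrow> \<bar>p l x - p l y\<bar> < \<epsilon>" for l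
    using \<epsilon> unfolding uniformly_continuous_on_def dist_real_def by metis
  then obtain \<eta> where \<eta>: "\<And>l. \<eta> l > 0" "\<And>l x y. x \<in> cube x0 h \<Longrightarrow> y \<in> cube x0 h \<Longrightarrow>
      dist x y < \<eta> l \<Longrightarrow> \<bar>p l x - p l y\<bar> < \<epsilon>"
    by metis
  define \<eta>0 where "\<eta>0 = Min (range \<eta>)"
  have \<eta>0: "\<eta>0 > 0" "\<And>l. \<eta>0 \<le> \<eta> l" unfolding \<eta>0_def using \<eta>(1) by auto
  \<comment> \<open>So many nodes that no \<open>p l\<close> varies by more than \<open>\<epsilon>\<close> between neighbours.\<close>
  obtain N :: nat where N: "real N > h / \<eta>0" using reals_Archimedean2 by blast
  have "h / \<eta>0 > 0" using h \<eta>0(1) by simp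
  with N have "real N > 0" by linarith
  then have Npos: "N > 0" by simp
  have hN: "h * (1 / real N) < \<eta>0" using N \<eta>0(1) \<open>real N > 0\<close> by (simp add: field_simps)
  define ok where
    "ok ds \<longleftrightarrow> distinct (map fst ds) \<and> (\<forall>d\<in>set ds. \<bar>snd d\<bar> = h)"
    for ds :: "('n \<times> real) list"
  have grid_v: "grid_average N ds (v k) x = (\<Sum>j\<in>UNIV. A$k$j * grid_average N ds (p j) x)"
    for ds k x
    by (simp add: v_def grid_average_sum)
  \<comment> \<open>Averaging \<open>p l\<close> first along its own direction leaves a difference quotient of \<open>u\<close>.\<close>
  have averaged: "\<bar>grid_average N ds (p l) x0\<bar> \<le> \<beta>" if "ok ds" "l \<in> fst ` set ds" for ds l
  proof -
    from that(2) obtain \<tau> where d: "(l, \<tau>) \<in> set ds" by auto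
    have \<tau>: "\<bar>\<tau>\<bar> = h" using that(1) d by (auto simp: ok_def)
    define ds' where "ds' = remove1 (l, \<tau>) ds"
    have "distinct ds" using that(1) by (auto simp: ok_def distinct_map)
    have ds': "distinct (map fst ds')" "\<And>d. d \<in> set ds' \<Longrightarrow> \<bar>snd d\<bar> \<le> h"
      using that(1) unfolding ok_def ds'_def
      by (auto simp: distinct_map \<open>distinct ds\<close> inj_on_def)
    have "l \<notin> fst ` set ds'"
      using that(1) d \<open>distinct ds\<close> unfolding ok_def ds'_def
      by (fastforce simp: distinct_map inj_on_def)
    have "\<bar>grid_average N ds' (segment_average N (l, \<tau>) (p l)) x0\<bar> \<le> \<beta>"
    proof (rule grid_average_abs_le[OF Npos ds'])
      fix y assume y: "y \<in> face x0 h (fst ` set ds')"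
      have seg: "y + (s * \<tau>) *\<^sub>R axis l 1 \<in> cube x0 h" if "0 \<le> s" "s \<le> 1" for s
      proof -
        have "\<bar>s * \<tau>\<bar> \<le> h" using that \<tau> h by (simp add: abs_mult mult_left_le_one_le)
        then show ?thesis
          using move_in_face[OF y \<open>l \<notin> _\<close>] face_subset_cube[of h] h by force
      qed
      have "\<bar>segment_average N (l, \<tau>) (p l) y - (u (y + \<tau> *\<^sub>R axis l 1) - u y) / \<tau>\<bar> \<le> \<epsilon>"
      proof (rule segment_average_derivative[OF Npos])
        show "\<tau> \<noteq> 0" using \<tau> h by auto
        show "((\<lambda>t. u ((y + (s * \<tau>) *\<^sub>R axis l 1) + t *\<^sub>R axis l 1)) has_real_derivative
          p l (y + (s * \<tau>) *\<^sub>R axis l 1)) (at 0)" if "0 \<le> s" "s \<le> 1" for s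
          by (rule der_u[OF seg[OF that]])
        show "\<bar>p l (y + (s * \<tau>) *\<^sub>R axis l 1) - p l (y + (t * \<tau>) *\<^sub>R axis l 1)\<bar> \<le> \<epsilon>"
          if "0 \<le> s" "s \<le> 1" "0 \<le> t" "t \<le> 1" "\<bar>s - t\<bar> \<le> 1 / real N" for s t
        proof (rule less_imp_le[OF \<eta>(2)[OF seg[OF that(1,2)] seg[OF that(3,4)]]])
          have "dist (y + (s * \<tau>) *\<^sub>R axis l (1::real)) (y + (t * \<tau>) *\<^sub>R axis l 1) = \<bar>s - t\<bar> * h"
            by (simp add: dist_norm scaleR_diff_left[symmetric] left_diff_distrib[symmetric]
              abs_mult \<tau> norm_axis_1)
          also have "\<dots> \<le> 1 / real N * h" using that(5) h by (intro mult_right_mono) auto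
          also have "\<dots> < \<eta> l" using hN \<eta>0(2)[of l] by (simp add: mult.commute)
          finally show "dist (y + (s * \<tau>) *\<^sub>R axis l (1::real)) (y + (t * \<tau>) *\<^sub>R axis l 1) < \<eta> l" .
        qed
      qed
      moreover have "\<bar>(u (y + \<tau> *\<^sub>R axis l 1) - u y) / \<tau>\<bar> \<le> 2 * U / h"
      proof -
        have "\<bar>u (y + \<tau> *\<^sub>R axis l 1)\<bar> \<le> U" "\<bar>u y\<bar> \<le> U"
          using bound_u seg[of 1] seg[of 0] by auto
        then have "\<bar>u (y + \<tau> *\<^sub>R axis l 1) - u y\<bar> \<le> 2 * U" by linarith
        then show ?thesis using h \<tau> by (simp add: divide_right_mono)
      qed
      ultimately show "\<bar>segment_average N (l, \<tau>) (p l) y\<bar> \<le> \<beta>"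
        unfolding \<beta>_def using eh by linarith
    qed
    then show ?thesis using grid_average_remove[OF d] by (simp add: ds'_def)
  qed
  \<comment> \<open>Induction on the number of missing directions; the empty list gives the value at \<open>x0\<close>.\<close>
  have "\<bar>grid_average N ds (p l) x0\<bar> \<le> c ^ (CARD('n) - length ds) * \<beta>" if "ok ds" for ds l
    using that
  proof (induction "CARD('n) - length ds" arbitrary: ds l)
    case 0
    have "card (fst ` set ds) = length ds"
      using 0(2) by (metis ok_def distinct_card set_map length_map)
    moreover have "card (fst ` set ds) \<le> CARD('n)" by (intro card_mono) auto
    ultimately have "fst ` set ds = UNIV"
      using 0(1) by (intro card_subset_eq) auto
    then show ?case using averaged[OF 0(2), of l] 0(1) by simp
  next
    case (Suc m)
    define T where "T = fst ` set ds"
    define z :: "real^'n" where "z = (\<chi> l. grid_average N ds (p l) x0)"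
    have Az: "(A *v z) $ k = grid_average N ds (v k) x0" for k
      by (simp add: z_def grid_v matrix_vector_mult_def)
    have c\<beta>: "\<beta> \<le> c ^ m * \<beta>" using c1 \<beta>0 by (simp add: mult_le_cancel_right1 one_le_power)
    have new: "\<bar>grid_average N ((k, \<tau>) # ds) (v k) x0\<bar> \<le> a * (c ^ m * \<beta>)"
      if "k \<notin> T" "\<bar>\<tau>\<bar> = h" for k \<tau>
    proof -
      have ok: "ok ((k, \<tau>) # ds)" using that Suc.prems by (auto simp: ok_def T_def)
      have IH: "\<bar>grid_average N ((k, \<tau>) # ds) (p j) x0\<bar> \<le> c ^ m * \<beta>" for j
      proof -
        have "m = CARD('n) - length ((k, \<tau>) # ds)" using Suc.hyps(2) by simp
        with Suc.hyps(1)[OF this ok, of j] show ?thesis by metis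
      qed
      have "\<bar>grid_average N ((k, \<tau>) # ds) (v k) x0\<bar>
          \<le> (\<Sum>j\<in>UNIV. \<bar>A$k$j\<bar> * \<bar>grid_average N ((k, \<tau>) # ds) (p j) x0\<bar>)"
        unfolding grid_v abs_mult[symmetric] by (rule sum_abs)
      also have "\<dots> \<le> (\<Sum>j\<in>UNIV. \<bar>A$k$j\<bar> * (c ^ m * \<beta>))"
        by (intro sum_mono mult_left_mono IH) auto
      also have "\<dots> = (\<Sum>j\<in>UNIV. \<bar>A$k$j\<bar>) * (c ^ m * \<beta>)"
        by (simp add: sum_distrib_right)
      also have "\<dots> \<le> a * (c ^ m * \<beta>)"
        unfolding a_def using \<beta>0 c1
        by (intro mult_right_mono member_le_sum[where f = "\<lambda>i. \<Sum>j\<in>UNIV. \<bar>A$i$j\<bar>"])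
          (auto intro: sum_nonneg)
      finally show ?thesis .
    qed
    have Azk: "\<bar>(A *v z) $ k\<bar> \<le> a * (c ^ m * \<beta>) + e * h" if k: "k \<notin> T" for k
    proof -
      have ds: "distinct (map fst ds)" "\<And>d. d \<in> set ds \<Longrightarrow> \<bar>snd d\<bar> \<le> h"
        using Suc.prems by (auto simp: ok_def)
      have inc: "v k (y + s *\<^sub>R axis k 1) \<le> v k (y + t *\<^sub>R axis k 1) + e * h"
        if y: "y \<in> face x0 h T" and st: "- h \<le> s" "s \<le> t" "t \<le> h" "t - s \<le> h" for y s t
      proof -
        have "v k (y + s *\<^sub>R axis k 1) \<le> v k (y + t *\<^sub>R axis k 1) + e * (t - s)"
        proof (rule increase_along_axis[OF st(2) der_v])
          fix r assume "s \<le> r" "r \<le> t"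
          then have "\<bar>r\<bar> \<le> h" using st by auto
          then show "y + r *\<^sub>R axis k 1 \<in> cube x0 h"
            using move_in_face[OF y k] face_subset_cube[of h] h by force
        qed
        also have "\<dots> \<le> v k (y + t *\<^sub>R axis k 1) + e * h"
          using st e by (auto intro: mult_left_mono)
        finally show ?thesis .
      qed
      have unit: "0 \<le> real m / real N * h" "real m / real N * h \<le> h" if "m < N" for m
        using that h by (auto intro!: mult_left_le_one_le simp del: times_divide_eq_left)
      \<comment> \<open>Upper bound by the average over the face extended forwards along \<open>e\<^sub>k\<close>; the lower bound
        below uses the face extended backwards.\<close>
      have "grid_average N ds (v k) x0
          \<le> grid_average N ds (\<lambda>y. segment_average N (k, h) (v k) y + e * h) x0"
      proof (rule grid_average_mono[OF Npos ds])
        fix y assume y: "y \<in> face x0 h (fst ` set ds)"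
        have "segment_average N (k, h) (\<lambda>_. v k y) y
            \<le> segment_average N (k, h) (\<lambda>x. v k x + e * h) y"
          unfolding segment_average_def fst_conv snd_conv
        proof (intro divide_right_mono sum_mono)
          fix m assume "m \<in> {..<N}"
          define t where "t = real m / real N * h"
          have "0 \<le> t" "t \<le> h" using unit[of m] \<open>m \<in> _\<close> by (auto simp only: t_def lessThan_iff)
          then have "v k y \<le> v k (y + t *\<^sub>R axis k 1) + e * h"
            using inc[of y 0 t] y h by (simp add: T_def)
          then show "v k y \<le> v k (y + (real m / real N * h) *\<^sub>R axis k 1) + e * h"
            by (simp only: t_def)
        qed simp
        then show "v k y \<le> segment_average N (k, h) (v k) y + e * h"
          by (simp add: segment_average_const segment_average_add_const Npos)
      qed
      then have upper: "(A *v z) $ k \<le> grid_average N ((k, h) # ds) (v k) x0 + e * h"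
        by (simp add: Az grid_average_add_const Npos grid_average_Cons_inner)
      have "grid_average N ds (segment_average N (k, - h) (v k)) x0
          \<le> grid_average N ds (\<lambda>y. v k y + e * h) x0"
      proof (rule grid_average_mono[OF Npos ds])
        fix y assume y: "y \<in> face x0 h (fst ` set ds)"
        have "segment_average N (k, - h) (v k) y
            \<le> segment_average N (k, - h) (\<lambda>_. v k y + e * h) y"
          unfolding segment_average_def fst_conv snd_conv
        proof (intro divide_right_mono sum_mono)
          fix m assume "m \<in> {..<N}"
          define t where "t = real m / real N * h"
          have "0 \<le> t" "t \<le> h" using unit[of m] \<open>m \<in> _\<close> by (auto simp only: t_def lessThan_iff)
          then have "v k (y + (- t) *\<^sub>R axis k 1) \<le> v k y + e * h"
            using inc[of y "- t" 0] y h by (simp add: T_def)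
          then show "v k (y + (real m / real N * - h) *\<^sub>R axis k 1) \<le> v k y + e * h"
            by (simp only: t_def mult_minus_right)
        qed simp
        then show "segment_average N (k, - h) (v k) y \<le> v k y + e * h"
          by (simp add: segment_average_const Npos)
      qed
      then have "grid_average N ((k, - h) # ds) (v k) x0 \<le> (A *v z) $ k + e * h"
        by (simp add: Az grid_average_add_const Npos grid_average_Cons_inner)
      with upper new[OF k, of h] new[OF k, of "- h"] h show ?thesis
        by (simp add: abs_le_iff)
    qed
    have "\<bar>if i \<in> T then z$i else (A *v z)$i\<bar> \<le> (1 + a) * (c ^ m * \<beta>)" for i
    proof (cases "i \<in> T")
      case True
      then have "\<bar>z$i\<bar> \<le> \<beta>" using averaged[OF Suc.prems] by (simp add: z_def T_def)
      moreover have "0 \<le> a * (c ^ m * \<beta>)" using a0 c1 \<beta>0 by simp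
      ultimately show ?thesis using True c\<beta> by (simp add: algebra_simps)
    next
      case False
      have "e * h \<le> \<beta>" unfolding \<beta>_def using U0 h \<epsilon> by simp
      then show ?thesis using Azk[OF False] False c\<beta> by (simp add: algebra_simps)
    qed
    then have "(\<Sum>i\<in>UNIV. \<bar>if i \<in> T then z$i else (A *v z)$i\<bar>)
        \<le> (\<Sum>i\<in>(UNIV::'n set). (1 + a) * (c ^ m * \<beta>))"
      by (intro sum_mono)
    then have "\<kappa> * (\<Sum>i\<in>UNIV. \<bar>if i \<in> T then z$i else (A *v z)$i\<bar>)
        \<le> \<kappa> * (\<Sum>i\<in>(UNIV::'n set). (1 + a) * (c ^ m * \<beta>))"
      by (rule mult_left_mono) (use \<kappa>(1) in simp)
    also have "\<dots> = (c - 1) * (c ^ m * \<beta>)"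
      by (simp add: c_def)
    also have "\<dots> \<le> c * (c ^ m * \<beta>)"
      using c1 \<beta>0 by (intro mult_right_mono) auto
    finally have "norm z \<le> c * (c ^ m * \<beta>)"
      using order_trans[OF \<kappa>(2)[of z T]] by blast
    then have "\<bar>z $ l\<bar> \<le> c ^ Suc m * \<beta>"
      using component_le_norm_cart[of z l] by simp
    then show ?case using Suc.hyps(2) by (simp add: z_def)
  qed
  from this[of "[]" l] have "\<bar>p l x0\<bar> \<le> c ^ CARD('n) * \<beta>"
    by (simp add: ok_def)
  also have "\<dots> = c ^ CARD('n) * (2 * U / h + e * h) + \<epsilon>'"
    using c1 by (simp add: \<beta>_def \<epsilon>_def algebra_simps)
  finally show "\<bar>p l x0\<bar> \<le> (1 + \<kappa> * CARD('n) * (1 + a)) ^ CARD('n) * (2 * U / h + e * h) + \<epsilon>'"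
    by (simp add: c_def)
qed



section \<open>Interior estimate with first order terms\<close>

lemma partial_deriv_works:
  fixes f :: "real^'n::finite \<Rightarrow> real"
  assumes "f differentiable (at x)"
  shows "((\<lambda>t. f (x + t *\<^sub>R axis i 1)) has_real_derivative partial_deriv i f x) (at 0)"
proof -
  have "(\<lambda>t. x + t *\<^sub>R axis i 1) differentiable (at (0::real))"
    by (auto intro!: derivative_intros)
  then have "(f \<circ> (\<lambda>t. x + t *\<^sub>R axis i 1)) differentiable (at (0::real))"
    by (rule differentiable_chain_at) (simp add: assms)
  then show ?thesis
    unfolding partial_deriv_def by (simp add: DERIV_deriv_iff_real_differentiable o_def)
qed

lemma dist_le_of_mem_cube:
  fixes x y :: "real^'n::finite" and h :: real
  assumes "y \<in> cube x h"
  shows "dist y x \<le> CARD('n) * h"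
proof -
  have "norm (y - x) \<le> (\<Sum>i\<in>UNIV. \<bar>(y - x)$i\<bar>)" by (rule norm_le_l1_cart)
  also have "\<dots> \<le> (\<Sum>i\<in>(UNIV::'n set). h)"
    using assms by (intro sum_mono) (simp add: mem_cube)
  finally show ?thesis by (simp add: dist_norm)
qed

text \<open>The first order terms are absorbed by a weighted maximum: \<open>M\<close> is finite because the gradient
  is continuous on the closed ball, and the weight vanishes on the boundary sphere.\<close>

lemma interior_gradient_bound:
  fixes A b :: "real^'n^'n::finite"
  defines "\<beta> \<equiv> \<Sum>i\<in>UNIV. \<Sum>j\<in>UNIV. \<bar>b$i$j\<bar>"
  assumes "fully_nonsingular A"
  shows "\<exists>K>0. \<forall>\<Omega> u c U R x. open \<Omega> \<longrightarrow> C2_on \<Omega> u \<longrightarrow>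
       (\<forall>x\<in>\<Omega>. \<forall>i. - (\<Sum>j\<in>UNIV. partial_deriv i (\<lambda>z. A$i$j * partial_deriv j u z) x
                              + b$i$j * partial_deriv j u x) \<le> c) \<longrightarrow>
       (\<forall>x\<in>\<Omega>. \<bar>u x\<bar> \<le> U) \<longrightarrow> R > 0 \<longrightarrow> cball x R \<subseteq> \<Omega> \<longrightarrow> K * R * \<beta> \<le> 1 \<longrightarrow>
       norm (grad u x) \<le> K * (U / R + \<bar>c\<bar> * R)"
proof -
  obtain \<kappa> where \<kappa>: "\<kappa> > 0"
    "\<And>T z. norm z \<le> \<kappa> * (\<Sum>i\<in>UNIV. \<bar>if i \<in> T then z$i else (A *v z)$i\<bar>)"
    using fully_nonsingular_bound[OF assms(2)] by blast
  define n :: real where "n = CARD('n)"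
  have n: "n \<ge> 1" unfolding n_def by (simp add: Suc_leI)
  define K0 where "K0 = (1 + \<kappa> * CARD('n) * (1 + (\<Sum>i\<in>UNIV. \<Sum>j\<in>UNIV. \<bar>A$i$j\<bar>))) ^ CARD('n)"
  have K0: "K0 > 0" unfolding K0_def using \<kappa>(1)
    by (intro zero_less_power add_pos_nonneg mult_nonneg_nonneg sum_nonneg add_nonneg_nonneg) auto
  have \<beta>0: "\<beta> \<ge> 0" unfolding \<beta>_def by (intro sum_nonneg) auto
  show ?thesis
  proof (intro exI[of _ "8 * n\<^sup>2 * K0"] conjI allI impI)
    show "8 * n\<^sup>2 * K0 > 0" using n K0 by simp
    fix \<Omega> u c U R and x :: "real^'n"
    assume \<Omega>: "open \<Omega>" "C2_on \<Omega> u"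
      and ineq: "\<forall>x\<in>\<Omega>. \<forall>i. - (\<Sum>j\<in>UNIV. partial_deriv i (\<lambda>z. A$i$j * partial_deriv j u z) x
                              + b$i$j * partial_deriv j u x) \<le> c"
      and bound_u: "\<forall>x\<in>\<Omega>. \<bar>u x\<bar> \<le> U"
      and R: "R > 0" "cball x R \<subseteq> \<Omega>" "8 * n\<^sup>2 * K0 * R * \<beta> \<le> 1"
    define p where "p j = partial_deriv j u" for j
    define g where "g y = norm (grad u y)" for y
    have diff: "u differentiable (at y)" "p j differentiable (at y)" if "y \<in> \<Omega>" for y j
      using \<Omega> that unfolding C2_on_def C1_on_def p_def
      by (meson differentiable_on_eq_differentiable_at)+
    have cont: "continuous_on \<Omega> (p j)" for j
      using \<Omega>(2) unfolding C2_on_def C1_on_def p_def by blast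
    have "continuous_on \<Omega> g"
      unfolding g_def grad_def using cont unfolding p_def by (intro continuous_intros)
    then have "continuous_on (cball x R) (\<lambda>y. (R - dist y x) * g y)"
      using R(2) by (intro continuous_intros) (rule continuous_on_subset)
    then have "\<exists>x0\<in>cball x R. \<forall>y\<in>cball x R. (R - dist y x) * g y \<le> (R - dist x0 x) * g x0"
      using R(1) by (intro continuous_attains_sup) auto
    then obtain x0 where x0: "x0 \<in> cball x R"
      and max: "\<And>y. y \<in> cball x R \<Longrightarrow> (R - dist y x) * g y \<le> (R - dist x0 x) * g x0"
      by blast
    define d where "d = R - dist x0 x"
    define M where "M = d * g x0"
    have d0: "d \<ge> 0" "d \<le> R" using x0 by (auto simp: d_def dist_commute)
    have "x \<in> \<Omega>" using R(1,2) by auto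
    then have U0: "U \<ge> 0" using bound_u abs_ge_zero order_trans by blast
    have pg: "\<bar>p j y\<bar> \<le> g y" for j y
      using component_le_norm_cart[of "grad u y" j] by (simp add: g_def grad_def p_def)
    have M0: "M \<ge> 0" unfolding M_def using d0 by (simp add: g_def)
    have "M \<le> 8 * n\<^sup>2 * K0 * (U + \<bar>c\<bar> * R\<^sup>2)"
    proof (cases "d = 0")
      case True
      then show ?thesis using K0 U0 by (simp add: M_def)
    next
      case False
      then have d: "d > 0" using d0 by simp
      \<comment> \<open>The cube of this size lies in the ball of radius \<open>d / 2\<close>, so that the weight drops by a
        factor of at most two on it.\<close>
      define h where "h = d / (2 * n)"
      have h: "h > 0" using d n by (simp add: h_def)
      define e where "e = \<bar>c\<bar> + \<beta> * (2 * M / d)"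
      have near: "d / 2 \<le> R - dist y x" "y \<in> \<Omega>" if "y \<in> cube x0 h" for y
      proof -
        have "dist y x0 \<le> d / 2"
          using dist_le_of_mem_cube[OF that] n by (simp add: h_def n_def)
        then show *: "d / 2 \<le> R - dist y x"
          using dist_triangle[of y x x0] by (simp add: d_def)
        then show "y \<in> \<Omega>" using R(2) d by (auto simp: dist_commute)
      qed
      have G: "\<bar>p j y\<bar> \<le> 2 * M / d" if "y \<in> cube x0 h" for y j
      proof -
        have "d / 2 * g y \<le> (R - dist y x) * g y"
          using near(1)[OF that] by (intro mult_right_mono) (auto simp: g_def)
        also have "\<dots> \<le> M"
          unfolding M_def d_def using near(1)[OF that] d by (intro max) (auto simp: dist_commute)
        finally have "g y \<le> 2 * M / d" using d by (simp add: field_simps)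
        with pg[of j y] show ?thesis by linarith
      qed
      have "\<bar>p l x0\<bar> \<le> K0 * (2 * U / h + e * h)" for l
        unfolding K0_def
      proof (rule point_gradient_bound[OF \<kappa> h])
        show "e \<ge> 0" unfolding e_def using \<beta>0 M0 d by simp
        show "continuous_on (cube x0 h) (p l)" for l
          using cont near(2) by (meson continuous_on_subset subsetI)
        fix y assume y: "y \<in> cube x0 h"
        show "\<bar>u y\<bar> \<le> U" using bound_u near(2)[OF y] by blast
        show "((\<lambda>t. u (y + t *\<^sub>R axis l 1)) has_real_derivative p l y) (at 0)" for l
          unfolding p_def using diff(1)[OF near(2)[OF y]] by (rule partial_deriv_works)
        fix k
        define D where "D = (\<Sum>j\<in>UNIV. A$k$j * partial_deriv k (p j) y)"
        have dp: "((\<lambda>t. p j (y + t *\<^sub>R axis k 1)) has_real_derivative partial_deriv k (p j) y) (at 0)" for j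
          using diff(2)[OF near(2)[OF y]] by (rule partial_deriv_works)
        have "partial_deriv k (\<lambda>z. A$k$j * p j z) y = A$k$j * partial_deriv k (p j) y" for j
          unfolding partial_deriv_def[of k "\<lambda>z. A$k$j * p j z"]
          by (rule DERIV_imp_deriv[OF DERIV_cmult[OF dp]])
        then have "- (D + (\<Sum>j\<in>UNIV. b$k$j * p j y)) \<le> c"
          using ineq[rule_format, OF near(2)[OF y], of k] by (simp add: D_def p_def sum.distrib)
        moreover have "\<bar>\<Sum>j\<in>UNIV. b$k$j * p j y\<bar> \<le> \<beta> * (2 * M / d)"
        proof -
          have "\<bar>\<Sum>j\<in>UNIV. b$k$j * p j y\<bar> \<le> (\<Sum>j\<in>UNIV. \<bar>b$k$j\<bar> * \<bar>p j y\<bar>)"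
            unfolding abs_mult[symmetric] by (rule sum_abs)
          also have "\<dots> \<le> (\<Sum>j\<in>UNIV. \<bar>b$k$j\<bar> * (2 * M / d))"
            by (intro sum_mono mult_left_mono G[OF y]) auto
          also have "\<dots> = (\<Sum>j\<in>UNIV. \<bar>b$k$j\<bar>) * (2 * M / d)"
            by (rule sum_distrib_right[symmetric])
          also have "\<dots> \<le> \<beta> * (2 * M / d)"
            unfolding \<beta>_def using M0 d
            by (intro mult_right_mono member_le_sum[where f = "\<lambda>i. \<Sum>j\<in>UNIV. \<bar>b$i$j\<bar>"])
              (auto intro: sum_nonneg)
          finally show ?thesis .
        qed
        ultimately have "- e \<le> D" unfolding e_def by linarith
        moreover have "((\<lambda>t. \<Sum>j\<in>UNIV. A$k$j * p j (y + t *\<^sub>R axis k 1)) has_real_derivative D) (at 0)"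
          unfolding D_def by (intro DERIV_sum DERIV_cmult dp)
        ultimately show "\<exists>D\<ge>-e. ((\<lambda>t. \<Sum>j\<in>UNIV. A$k$j * p j (y + t *\<^sub>R axis k 1)) has_real_derivative D) (at 0)"
          by blast
      qed
      then have "(\<Sum>l\<in>UNIV. \<bar>grad u x0 $ l\<bar>) \<le> (\<Sum>l\<in>(UNIV::'n set). K0 * (2 * U / h + e * h))"
        by (intro sum_mono) (simp add: grad_def p_def)
      then have "g x0 \<le> n * (K0 * (2 * U / h + e * h))"
        using norm_le_l1_cart[of "grad u x0"] by (simp add: g_def n_def)
      then have "M \<le> d * (n * (K0 * (2 * U / h + e * h)))"
        unfolding M_def using d by (intro mult_left_mono) auto
      also have "\<dots> = K0 * (4 * n\<^sup>2 * U + \<bar>c\<bar> * d\<^sup>2 / 2 + \<beta> * M * d)"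
        using d n by (simp add: h_def e_def field_simps power2_eq_square)
      finally have main: "M \<le> K0 * (4 * n\<^sup>2 * U) + K0 * (\<bar>c\<bar> * d\<^sup>2 / 2) + K0 * \<beta> * d * M"
        by (simp add: algebra_simps)
      have n2: "n\<^sup>2 \<ge> 1" using n by (simp add: one_le_power)
      \<comment> \<open>Smallness of \<open>R\<close> enters here, and only here: the term with \<open>M\<close> moves to the left.\<close>
      have "8 * (K0 * \<beta> * d) \<le> 8 * (n\<^sup>2 * K0 * \<beta> * R)"
      proof -
        have "K0 * \<beta> * d \<le> K0 * \<beta> * R" using d0 K0 \<beta>0 by (intro mult_left_mono) auto
        also have "\<dots> \<le> n\<^sup>2 * (K0 * \<beta> * R)"
          using n2 K0 \<beta>0 R(1) mult_right_mono[of 1 "n\<^sup>2" "K0 * \<beta> * R"] by simp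
        finally show ?thesis by (simp add: mult.assoc)
      qed
      with R(3) have "K0 * \<beta> * d \<le> 1 / 2" by (simp add: algebra_simps)
      then have "K0 * \<beta> * d * M \<le> 1 / 2 * M" using M0 by (rule mult_right_mono)
      with main have "M \<le> 2 * (K0 * (4 * n\<^sup>2 * U)) + K0 * (\<bar>c\<bar> * d\<^sup>2)" by linarith
      also have "K0 * (\<bar>c\<bar> * d\<^sup>2) \<le> (8 * n\<^sup>2 * K0) * (\<bar>c\<bar> * R\<^sup>2)"
      proof (intro mult_mono)
        show "K0 \<le> 8 * n\<^sup>2 * K0" using n2 K0 by simp
        show "d\<^sup>2 \<le> R\<^sup>2" using d0 by (intro power_mono) auto
      qed (use K0 in auto)
      finally show ?thesis by (simp add: algebra_simps)
    qed
    moreover have "R * g x \<le> M" using max[of x] R(1) by (simp add: M_def d_def)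
    ultimately have "R * g x \<le> 8 * n\<^sup>2 * K0 * (U + \<bar>c\<bar> * R\<^sup>2)" by linarith
    then show "norm (grad u x) \<le> 8 * n\<^sup>2 * K0 * (U / R + \<bar>c\<bar> * R)"
      using R(1) by (simp add: g_def field_simps power2_eq_square)
  qed
qed

section \<open>Three dimensions\<close>

lemma two_by_two_complementarity:
  fixes a b c d x y :: real
  assumes "x = 0 \<or> a * x + b * y = 0" "y = 0 \<or> c * x + d * y = 0"
    and "a \<noteq> 0" "d \<noteq> 0" "a * d - b * c \<noteq> 0"
  shows "x = 0 \<and> y = 0"
proof (cases "x = 0 \<or> y = 0")
  case True
  with assms(1-4) show ?thesis by auto
next
  case False
  then have eqs: "a * x + b * y = 0" "c * x + d * y = 0" using assms(1,2) by auto
  have "(a * d - b * c) * x = d * (a * x + b * y) - b * (c * x + d * y)"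
    by (simp add: algebra_simps)
  also have "\<dots> = 0" by (simp only: eqs mult_zero_right diff_self)
  finally show ?thesis using assms(5) False by simp
qed

lemma fully_nonsingular_3:
  fixes A :: "real^3^3"
  assumes "A$1$1 \<noteq> 0" "A$2$2 \<noteq> 0" "A$3$3 \<noteq> 0"
    and "A$1$1 * A$2$2 - A$1$2 * A$2$1 \<noteq> 0"
    and "A$1$1 * A$3$3 - A$1$3 * A$3$1 \<noteq> 0"
    and "A$2$2 * A$3$3 - A$2$3 * A$3$2 \<noteq> 0"
    and "det A \<noteq> 0"
  shows "fully_nonsingular A"
  unfolding fully_nonsingular_def
proof (intro allI impI)
  fix z :: "real^3" assume "\<forall>i. z$i * (A *v z)$i = 0"
  then have z: "z$1 = 0 \<or> A$1$1 * z$1 + A$1$2 * z$2 + A$1$3 * z$3 = 0"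
      "z$2 = 0 \<or> A$2$1 * z$1 + A$2$2 * z$2 + A$2$3 * z$3 = 0"
      "z$3 = 0 \<or> A$3$1 * z$1 + A$3$2 * z$2 + A$3$3 * z$3 = 0"
    by (auto simp: forall_3 matrix_vector_mult_def sum_3)
  consider "z$1 = 0" | "z$2 = 0" | "z$3 = 0" | "A *v z = 0"
    using z by (auto simp: vec_eq_iff forall_3 matrix_vector_mult_def sum_3)
  then have "z$1 = 0 \<and> z$2 = 0 \<and> z$3 = 0"
  proof cases
    case 1
    have "z$2 = 0 \<and> z$3 = 0"
      by (rule two_by_two_complementarity[OF _ _ assms(2,3,6)]) (use z 1 in simp_all)
    with 1 show ?thesis by simp
  next
    case 2
    have "z$1 = 0 \<and> z$3 = 0"
      by (rule two_by_two_complementarity[OF _ _ assms(1,3,5)]) (use z 2 in simp_all)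
    with 2 show ?thesis by simp
  next
    case 3
    have "z$1 = 0 \<and> z$2 = 0"
      by (rule two_by_two_complementarity[OF _ _ assms(1,2,4)]) (use z 3 in simp_all)
    with 3 show ?thesis by simp
  next
    case 4
    have "invertible A" using assms(7) by (simp add: invertible_det_nz)
    then have "z = 0" using 4
      by (metis invertible_def matrix_left_invertible_ker)
    then show ?thesis by simp
  qed
  then show "z = 0" by (simp add: vec_eq_iff forall_3)
qed

theorem theorem1p2:
  fixes A b :: "real^3^3" and C1 C2 C3 C4 C5 :: real
  assumes "C1 > 0" and "C2 > 0" and "C3 > 0"
    and "\<forall>i j. \<bar>A$i$j\<bar> \<le> C1"
    and "det A \<noteq> 0" and "inverse \<bar>det A\<bar> \<le> C2"
    and "(A$1$1 * A$2$2 - A$1$2 * A$2$1) * (A$1$1 * A$3$3 - A$1$3 * A$3$1)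
           * (A$2$2 * A$3$3 - A$2$3 * A$3$2) \<noteq> 0"
    and "A$1$1 * A$2$2 * A$3$3 \<noteq> 0"
    and "(A$1$1 * A$2$2 + A$2$1 * A$1$2) * (A$1$1 * A$2$2 - 3 * (A$2$1 * A$1$2)) > 0"
    and "(A$1$1 * A$3$3 + A$3$1 * A$1$3) * (A$1$1 * A$3$3 - 3 * (A$3$1 * A$1$3)) > 0"
    and "(A$2$2 * A$3$3 + A$2$3 * A$3$2) * (A$2$2 * A$3$3 - 3 * (A$2$3 * A$3$2)) > 0"
    and "\<forall>i j. \<bar>b$i$j\<bar> \<le> C3"
  shows "\<exists>Cbar :: real \<Rightarrow> real.
    (\<forall>\<delta>>0. Cbar \<delta> > 0) \<and>
    Cbar \<in> O[at_right 0](\<lambda>\<delta>. 1 / \<delta>) \<and>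
    (\<forall>(\<Omega> :: (real^3) set) (u :: real^3 \<Rightarrow> real) (y :: real^3) (\<delta> :: real).
       open \<Omega> \<longrightarrow> connected \<Omega> \<longrightarrow> C2_on \<Omega> u \<longrightarrow>
       (\<forall>x\<in>\<Omega>. \<forall>i. - (\<Sum>j\<in>UNIV. partial_deriv i (\<lambda>z. A$i$j * partial_deriv j u z) x
                              + b$i$j * partial_deriv j u x) \<le> C4) \<longrightarrow>
       (\<forall>x\<in>\<Omega>. \<bar>u x\<bar> \<le> C5) \<longrightarrow>
       y \<in> \<Omega> \<longrightarrow> \<delta> > 0 \<longrightarrow>
       (\<forall>i j. i \<noteq> j \<longrightarrow>
          \<delta> * \<bar>(A$i$j * b$j$i) / (A$i$i * A$j$j - A$i$j * A$j$i + 2 * \<bar>A$i$j * A$j$i\<bar>)\<bar>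
            * (1 + \<bar>(A$i$j * A$j$i) / (A$i$i * A$j$j)\<bar>) < 1 / 8) \<longrightarrow>
       (\<forall>i j. i \<noteq> j \<longrightarrow>
          \<delta> * \<bar>(A$i$j * b$i$j) / (A$i$i * A$j$j - A$i$j * A$j$i - 2 * \<bar>A$i$j * A$j$i\<bar>)\<bar>
            * (1 + \<bar>(A$i$j * A$j$i) / (A$i$i * A$j$j)\<bar>) < 1 / 8) \<longrightarrow>
       cube y (2 * \<delta>) \<subseteq> \<Omega> \<longrightarrow>
       (\<forall>x \<in> cube y \<delta>. norm (grad u x) \<le> Cbar \<delta>))"
proof -
  have "fully_nonsingular A"
    using assms(5,7,8) by (intro fully_nonsingular_3) auto
  define \<beta> where "\<beta> = (\<Sum>i\<in>UNIV. \<Sum>j\<in>UNIV. \<bar>b$i$j\<bar>)"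
  have \<beta>0: "\<beta> \<ge> 0" unfolding \<beta>_def by (intro sum_nonneg) auto
  obtain K where K: "K > 0" and bound:
    "\<forall>\<Omega> u c U R x. open \<Omega> \<longrightarrow> C2_on \<Omega> u \<longrightarrow>
       (\<forall>x\<in>\<Omega>. \<forall>i. - (\<Sum>j\<in>UNIV. partial_deriv i (\<lambda>z. A$i$j * partial_deriv j u z) x
                              + b$i$j * partial_deriv j u x) \<le> c) \<longrightarrow>
       (\<forall>x\<in>\<Omega>. \<bar>u x\<bar> \<le> U) \<longrightarrow> R > 0 \<longrightarrow> cball x R \<subseteq> \<Omega> \<longrightarrow> K * R * \<beta> \<le> 1 \<longrightarrow>
       norm (grad u x) \<le> K * (U / R + \<bar>c\<bar> * R)"
    using interior_gradient_bound[OF \<open>fully_nonsingular A\<close>, of b, folded \<beta>_def] by blast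
  \<comment> \<open>Up to this radius the first order terms are absorbed. For larger \<open>\<delta>\<close> the balls of radius
    \<open>\<delta>0\<close> about the points of the inner cube still lie in the outer one, and the bound at radius
    \<open>\<delta>0\<close> is used.\<close>
  define \<delta>0 where "\<delta>0 = 1 / (K * \<beta> + 1)"
  have K\<beta>: "K * \<beta> \<ge> 0" using K \<beta>0 by simp
  have \<delta>0: "\<delta>0 > 0" "\<delta>0 \<le> 1" unfolding \<delta>0_def using K\<beta> by auto
  have small: "K * R * \<beta> \<le> 1" if "0 < R" "R \<le> \<delta>0" for R
  proof -
    have "(K * \<beta>) * R \<le> (K * \<beta>) * \<delta>0" using that K\<beta> by (intro mult_left_mono)
    also have "\<dots> \<le> 1" unfolding \<delta>0_def using K\<beta> by simp
    finally show ?thesis by (simp add: mult_ac)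
  qed
  define N where "N = K * (\<bar>C5\<bar> + \<bar>C4\<bar>) + 1"
  have N: "N > 0" unfolding N_def using K by (intro add_nonneg_pos) auto
  define Cbar where "Cbar \<delta> = N / min \<delta> \<delta>0" for \<delta>
  have pos: "\<forall>\<delta>>0. Cbar \<delta> > 0" unfolding Cbar_def using N \<delta>0 by simp
  have order: "Cbar \<in> O[at_right 0](\<lambda>\<delta>. 1 / \<delta>)"
  proof (rule bigoI)
    show "\<forall>\<^sub>F \<delta> in at_right 0. norm (Cbar \<delta>) \<le> N * norm (1 / \<delta>)"
      using eventually_at_right_real[OF \<delta>0(1)]
      by eventually_elim (use N in \<open>simp add: Cbar_def\<close>)
  qed
  have estimate: "norm (grad u x) \<le> Cbar \<delta>"
    if "open \<Omega>" "C2_on \<Omega> u"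
      and ineq: "\<forall>x\<in>\<Omega>. \<forall>i. - (\<Sum>j\<in>UNIV. partial_deriv i (\<lambda>z. A$i$j * partial_deriv j u z) x
                              + b$i$j * partial_deriv j u x) \<le> C4"
      and bdd: "\<forall>x\<in>\<Omega>. \<bar>u x\<bar> \<le> C5"
      and \<delta>: "\<delta> > 0" "cube y (2 * \<delta>) \<subseteq> \<Omega>" "x \<in> cube y \<delta>"
    for \<Omega> u y \<delta> and x :: "real^3"
  proof -
    define R where "R = min \<delta> \<delta>0"
    have R: "R > 0" "R \<le> \<delta>" "R \<le> \<delta>0" unfolding R_def using \<delta>(1) \<delta>0 by auto
    have "cball x R \<subseteq> cube y (2 * \<delta>)"
    proof
      fix z assume "z \<in> cball x R"
      then have zx: "\<bar>z$i - x$i\<bar> \<le> \<delta>" for i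
        using component_le_norm_cart[of "z - x" i] R(2) by (simp add: dist_norm norm_minus_commute)
      have xy: "\<bar>x$i - y$i\<bar> \<le> \<delta>" for i using \<delta>(3) by (simp add: mem_cube)
      have "\<bar>z$i - y$i\<bar> \<le> 2 * \<delta>" for i using zx[of i] xy[of i] by linarith
      then show "z \<in> cube y (2 * \<delta>)" by (simp add: mem_cube)
    qed
    then have "cball x R \<subseteq> \<Omega>" using \<delta>(2) by blast
    then have "norm (grad u x) \<le> K * (C5 / R + \<bar>C4\<bar> * R)"
      using bound that(1,2) ineq bdd R(1) small[OF R(1,3)] by blast
    also have "C5 / R + \<bar>C4\<bar> * R \<le> (\<bar>C5\<bar> + \<bar>C4\<bar>) / R"
    proof -
      \<comment> \<open>This is where \<open>\<delta>0 \<le> 1\<close> matters: the term from the right-hand side is then also of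
        order \<open>1 / R\<close>.\<close>
      have "R * R \<le> 1" using R \<delta>0 by (intro mult_le_one) auto
      then have "\<bar>C4\<bar> * (R * R) \<le> \<bar>C4\<bar>" by (rule mult_left_le) simp
      then have "\<bar>C4\<bar> * R \<le> \<bar>C4\<bar> / R" using R(1) by (simp add: pos_le_divide_eq mult.assoc)
      moreover have "C5 / R \<le> \<bar>C5\<bar> / R" using R(1) by (intro divide_right_mono) auto
      ultimately show ?thesis by (simp add: add_divide_distrib)
    qed
    then have "K * (C5 / R + \<bar>C4\<bar> * R) \<le> K * ((\<bar>C5\<bar> + \<bar>C4\<bar>) / R)"
      using K by (intro mult_left_mono) auto
    also have "\<dots> \<le> N / R" unfolding N_def using R(1) by (simp add: divide_right_mono)
    finally show ?thesis by (simp add: Cbar_def R_def)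
  qed
  show ?thesis
    by (intro exI[of _ Cbar] conjI pos order, intro allI impI ballI, rule estimate)
qed

end
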